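(* Let $\mathbf{x}$ be a point in $\mathbb{R}^2$ with irrational slope and let $y$ be an irrational real number having irrationality measure $\omega(y)=1$. Then the upper bound $$\mu(\mathbf{x},\mathbf{y})\le\frac12$$ holds for almost all points $\mathbf{y}$ of the line $\mathbb{R}\begin{pmatrix} y \\ 1 \end{pmatrix}$ (with respect to one-dimensional Lebesgue measure on this line).
   Context: $\Gamma=\mathrm{SL}(2,\mathbb{Z})$ acts on column vectors of $\mathbb{R}^2$ by left multiplication. For $\mathbf{z}=\begin{pmatrix} z_1 \\ z_2 \end{pmatrix}$, $|\mathbf{z}|=\max(|z_1|,|z_2|)$, and the slope of $\mathbf{z}$ is $z_1/z_2$ (when $z_2\neq0$). For a matrix $\gamma$, $|\gamma|$ is the maximum of the absolute values of its entries. For an irrational real number $\alpha$, the irrationality measure $\omega(\alpha)$ is the supremum of the real numbers $\omega$ such that $|v\alpha+u|\le|v|^{-\omega}$ has infinitely many solutions in integers $(v,u)$ with $v\neq0$. For $\mathbf{x},\mathbf{y}\in\mathbb{R}^2$, $\mu(\mathbf{x},\mathbf{y})$ is the supremum of the real numbers $\mu$ for which there exist infinitely many $\gamma\in\Gamma$ with $|\gamma\mathbf{x}-\mathbf{y}|\le|\gamma|^{-\mu}$. *)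

theory Defs
  imports "HOL-Analysis.Analysis"
begin

definition SL2Z :: "(int^2^2) set"
  where "SL2Z = {\<gamma>. det \<gamma> = 1}"

definition act :: "int^2^2 \<Rightarrow> real^2 \<Rightarrow> real^2"
  where "act \<gamma> z = map_matrix real_of_int \<gamma> *v z"

definition mat_height :: "int^2^2 \<Rightarrow> int"
  where "mat_height \<gamma> = Max {\<bar>\<gamma> $ i $ j\<bar> | i j. True}"

definition irrational_slope :: "real^2 \<Rightarrow> bool"
  where "irrational_slope z \<longleftrightarrow> z $ 2 \<noteq> 0 \<and> z $ 1 / z $ 2 \<notin> \<rat>"

(* The two exponents below are suprema in the extended reals, since the sets of admissible
   real exponents may be unbounded. *)

definition irrationality_measure :: "real \<Rightarrow> ereal"
  where "irrationality_measure \<alpha> =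
    Sup {ereal \<omega> | \<omega>. infinite {(v::int, u::int).
      v \<noteq> 0 \<and> \<bar>real_of_int v * \<alpha> + real_of_int u\<bar> \<le> real_of_int \<bar>v\<bar> powr (- \<omega>)}}"

(* The library's infnorm is the maximum norm; see infnorm_eq_max below. *)

definition orbit_exponent :: "real^2 \<Rightarrow> real^2 \<Rightarrow> ereal"
  where "orbit_exponent x y =
    Sup {ereal \<mu> | \<mu>. infinite {\<gamma> \<in> SL2Z.
      infnorm (act \<gamma> x - y) \<le> real_of_int (mat_height \<gamma>) powr (- \<mu>)}}"

lemma infnorm_eq_max: "infnorm (z :: real^2) = max \<bar>z $ 1\<bar> \<bar>z $ 2\<bar>"
proof -
  have "{\<bar>z $ i\<bar> | i. i \<in> UNIV} = {\<bar>z $ 1\<bar>, \<bar>z $ 2\<bar>}"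
    unfolding setcompr_eq_image Collect_mem_eq UNIV_2 by simp
  then show ?thesis
    by (simp only: infnorm_cart) (simp add: cSup_eq_Max)
qed

lemma mat_height_eq_Max:
  "mat_height \<gamma> = Max {\<bar>\<gamma> $ 1 $ 1\<bar>, \<bar>\<gamma> $ 1 $ 2\<bar>, \<bar>\<gamma> $ 2 $ 1\<bar>, \<bar>\<gamma> $ 2 $ 2\<bar>}"
proof -
  have "{\<bar>\<gamma> $ i $ j\<bar> | i j. True} = (\<Union>i\<in>UNIV. (\<lambda>j. \<bar>\<gamma> $ i $ j\<bar>) ` UNIV)"
    by blast
  also have "\<dots>
      = {\<bar>\<gamma> $ 1 $ 1\<bar>, \<bar>\<gamma> $ 1 $ 2\<bar>, \<bar>\<gamma> $ 2 $ 1\<bar>, \<bar>\<gamma> $ 2 $ 2\<bar>}"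
    unfolding UNIV_2 by (simp add: insert_commute)
  finally show ?thesis
    by (simp only: mat_height_def)
qed

end

theory Submission
  imports Defs "HOL-Real_Asymp.Real_Asymp"
begin

text \<open>
  By Borel--Cantelli over dyadic heights \<open>N\<close>, it suffices that for \<open>\<mu> > 1/2\<close> the number of \<open>\<gamma>\<close> of
  height at most \<open>2 N\<close> with \<open>\<gamma> x\<close> within \<open>N powr - \<mu>\<close> of a fixed compact piece of the line (away
  from the origin) is \<open>O(N powr (1 - \<mu> + \<eta>))\<close> with \<open>\<eta> < 2 \<mu> - 1\<close>.  Since \<open>y\<close> has irrationality
  measure 1, there are coprime \<open>p, q\<close> with \<open>\<bar>q y - p\<bar>\<close> and \<open>1 / q\<close> both equal to \<open>N powr (- \<mu> / 2)\<close>
  up to small exponents.  Map \<open>\<gamma>\<close> with rows \<open>R\<^sub>1, R\<^sub>2\<close> to the primitive vector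
  \<open>w = q R\<^sub>1 - p R\<^sub>2\<close>.  Then \<open>L = w \<cdot> x\<close> is comparable to \<open>q y - p\<close> and \<open>w\<^sub>1 / L = O(N)\<close>, so few
  primitive \<open>w\<close> occur, and each \<open>w\<close> comes from few \<open>\<gamma>\<close>.
\<close>

subsection \<open>Unimodular integer matrices\<close>

lemma SL2Z_iff: "\<gamma> \<in> SL2Z \<longleftrightarrow> \<gamma> $ 1 $ 1 * \<gamma> $ 2 $ 2 - \<gamma> $ 1 $ 2 * \<gamma> $ 2 $ 1 = 1"
  by (simp add: SL2Z_def det_2)

lemma act_nth: "act \<gamma> z $ i = \<gamma> $ i $ 1 * z $ 1 + \<gamma> $ i $ 2 * z $ 2"
  by (simp add: act_def matrix_vector_mult_def sum_2 map_matrix_def)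

lemma abs_le_mat_height: "\<bar>\<gamma> $ i $ j\<bar> \<le> mat_height \<gamma>"
proof -
  have "i = 1 \<or> i = 2" "j = 1 \<or> j = 2"
    by (rule exhaust_2)+
  then show ?thesis
    unfolding mat_height_eq_Max by (intro Max_ge) auto
qed

lemma mat_height_pos:
  assumes "\<gamma> \<in> SL2Z"
  shows "0 < mat_height \<gamma>"
proof (rule ccontr)
  assume "\<not> 0 < mat_height \<gamma>"
  then have "\<gamma> $ i $ j = 0" for i j
    using abs_le_mat_height[of \<gamma> i j] by linarith
  then show False
    using assms by (simp add: SL2Z_iff)
qed

lemma finite_mat_height_le: "finite {\<gamma>. mat_height \<gamma> \<le> n}"
proof (rule finite_subset)
  let ?I = "{- n..n}"
  let ?f = "\<lambda>(a, b, c, d). \<chi> i j. if i = (1::2) then (if j = (1::2) then a else b)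
      else (if j = 1 then c else d)"
  show "{\<gamma>. mat_height \<gamma> \<le> n} \<subseteq> ?f ` (?I \<times> ?I \<times> ?I \<times> ?I)"
  proof
    fix \<gamma> :: "int^2^2" assume "\<gamma> \<in> {\<gamma>. mat_height \<gamma> \<le> n}"
    then have *: "\<gamma> $ i $ j \<in> ?I" for i j
      using abs_le_mat_height[of \<gamma> i j] by auto
    have "\<gamma> = ?f (\<gamma> $ 1 $ 1, \<gamma> $ 1 $ 2, \<gamma> $ 2 $ 1, \<gamma> $ 2 $ 2)"
      by (simp add: vec_eq_iff forall_2)
    then show "\<gamma> \<in> ?f ` (?I \<times> ?I \<times> ?I \<times> ?I)"
      using * by blast
  qed
qed auto

text \<open>Coprimality turns the cross relation into mutual divisibility of corresponding entries,
  so these agree up to sign. Unequal signs force \<open>a * b = 0\<close>, and a zero entry carries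
  either sign.\<close>

lemma parallel_primitive:
  fixes a b c d :: int
  assumes "coprime a b" "coprime c d" "a * d = b * c"
  obtains "c = a" "d = b" | "c = - a" "d = - b"
proof -
  have "a dvd b * c" "c dvd a * d" "b dvd a * d" "d dvd b * c"
    using dvd_triv_left[of a d] dvd_triv_left[of b c] dvd_triv_right[of c b] dvd_triv_right[of d a]
    by (simp_all only: assms(3))
  then have "a dvd c" "c dvd a" "b dvd d" "d dvd b"
    using assms(1,2) by (simp_all add: coprime_dvd_mult_left_iff coprime_dvd_mult_right_iff coprime_commute)
  then have "\<bar>a\<bar> = \<bar>c\<bar>" "\<bar>b\<bar> = \<bar>d\<bar>"
    using zdvd_antisym_abs by blast+
  then have "c = a \<or> c = - a" "d = b \<or> d = - b"
    by linarith+
  moreover have "a = 0 \<or> b = 0" if "c = a \<and> d = - b \<or> c = - a \<and> d = b"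
    using that assms(3) by auto
  ultimately show thesis
    using that by fastforce
qed

text \<open>The row \<open>(q, - p)\<close> is primitive, and right multiplication by a unimodular
  matrix preserves this: applying the inverse of \<gamma> to a Bezout relation for
  \<open>p, q\<close> gives one for the new row.\<close>

lemma SL2Z_coprime_combination:
  fixes p q :: int
  assumes "\<gamma> \<in> SL2Z" "coprime p q"
  shows "coprime (q * \<gamma> $ 1 $ 1 - p * \<gamma> $ 2 $ 1) (q * \<gamma> $ 1 $ 2 - p * \<gamma> $ 2 $ 2)"
proof -
  obtain a b where ab: "a * p + b * q = 1"
    using assms(2) by (metis bezout_int coprime_imp_gcd_eq_1)
  let ?v1 = "\<gamma> $ 1 $ 1" and ?u1 = "\<gamma> $ 1 $ 2" and ?v2 = "\<gamma> $ 2 $ 1" and ?u2 = "\<gamma> $ 2 $ 2"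
  have "(q * ?v1 - p * ?v2) * (?u2 * b + ?u1 * a) + (q * ?u1 - p * ?u2) * (- ?v2 * b - ?v1 * a)
      = (a * p + b * q) * (?v1 * ?u2 - ?u1 * ?v2)"
    by (simp add: algebra_simps)
  then have 1: "(q * ?v1 - p * ?v2) * (?u2 * b + ?u1 * a) + (q * ?u1 - p * ?u2) * (- ?v2 * b - ?v1 * a) = 1"
    using ab assms(1) by (simp add: SL2Z_iff)
  show ?thesis
  proof (rule coprimeI)
    fix c assume "c dvd q * ?v1 - p * ?v2" "c dvd q * ?u1 - p * ?u2"
    then have "c dvd (q * ?v1 - p * ?v2) * (?u2 * b + ?u1 * a) + (q * ?u1 - p * ?u2) * (- ?v2 * b - ?v1 * a)"
      by (intro dvd_add dvd_mult2)
    then show "is_unit c"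
      unfolding 1 .
  qed
qed

text \<open>The fiber is an orbit of the unipotent matrices \<open>I + n (p, q)^T (q, - p)\<close>,
  which fix the row \<open>(q, - p)\<close>. Equality of the combinations yields a difference
  \<open>(p d, q d)\<close> of the two rows, equality of the determinants makes \<open>d\<close>
  parallel to the combined row \<open>w\<close>, and primitivity of \<open>w\<close> makes the
  factor an integer.\<close>

lemma SL2Z_fiber:
  fixes p q :: int
  assumes "\<gamma> \<in> SL2Z" "\<gamma>' \<in> SL2Z" "coprime p q" "q \<noteq> 0"
    and row: "\<And>j. q * \<gamma>' $ 1 $ j - p * \<gamma>' $ 2 $ j = q * \<gamma> $ 1 $ j - p * \<gamma> $ 2 $ j"
  obtains n where "\<And>j. \<gamma>' $ 1 $ j = \<gamma> $ 1 $ j + n * p * (q * \<gamma> $ 1 $ j - p * \<gamma> $ 2 $ j)"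
    "\<And>j. \<gamma>' $ 2 $ j = \<gamma> $ 2 $ j + n * q * (q * \<gamma> $ 1 $ j - p * \<gamma> $ 2 $ j)"
proof -
  have "\<exists>d. \<gamma>' $ 1 $ j = \<gamma> $ 1 $ j + p * d \<and> \<gamma>' $ 2 $ j = \<gamma> $ 2 $ j + q * d" for j
  proof -
    have e: "q * (\<gamma>' $ 1 $ j - \<gamma> $ 1 $ j) = p * (\<gamma>' $ 2 $ j - \<gamma> $ 2 $ j)"
      using row[of j] by (simp add: algebra_simps)
    then have "q dvd \<gamma>' $ 2 $ j - \<gamma> $ 2 $ j"
      using assms(3) by (metis coprime_commute coprime_dvd_mult_right_iff dvd_triv_left)
    then obtain d where d: "\<gamma>' $ 2 $ j - \<gamma> $ 2 $ j = q * d" ..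
    then have "\<gamma>' $ 1 $ j - \<gamma> $ 1 $ j = p * d"
      using e assms(4) by (simp add: mult.left_commute)
    with d show ?thesis
      by (intro exI[of _ d]) (simp add: algebra_simps)
  qed
  then obtain d where d: "\<And>j. \<gamma>' $ 1 $ j = \<gamma> $ 1 $ j + p * d j"
      "\<And>j. \<gamma>' $ 2 $ j = \<gamma> $ 2 $ j + q * d j"
    by metis
  define w where "w j = q * \<gamma> $ 1 $ j - p * \<gamma> $ 2 $ j" for j
  have "w 1 * d 2 = w 2 * d 1"
    using assms(1,2) unfolding SL2Z_iff d w_def by algebra
  moreover have cop: "coprime (w 1) (w 2)"
    unfolding w_def using assms by (intro SL2Z_coprime_combination)
  ultimately obtain a b where ab: "a * w 1 + b * w 2 = 1" and par: "w 1 * d 2 = w 2 * d 1"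
    by (metis bezout_int coprime_imp_gcd_eq_1)
  \<comment> \<open>Since \<open>d\<close> is parallel to \<open>w\<close> and
    \<open>a * w 1 + b * w 2 = 1\<close>, pairing \<open>d\<close> with \<open>(a, b)\<close> reads
    off the factor.\<close>
  define n where "n = a * d 1 + b * d 2"
  have "d 1 = n * w 1" "d 2 = n * w 2"
    using ab par unfolding n_def by algebra+
  then have "d j = n * w j" for j
    using exhaust_2[of j] by auto
  then show thesis
    by (intro that[of n]) (simp_all add: d w_def mult.assoc mult.left_commute)
qed

section \<open>Separating and counting orbit points by the linear form that vanishes on the line of
  slope \<open>p / q\<close>\<close>

definition comb_form :: "int \<Rightarrow> int \<Rightarrow> real^2 \<Rightarrow> real"
  where "comb_form p q z = q * z $ 1 - p * z $ 2"

text \<open>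
  Distinct primitive rows have well separated slopes, because
  \<open>w\<^sub>1 / L - w'\<^sub>1 / L' = x\<^sub>2 (w\<^sub>1 w'\<^sub>2 - w\<^sub>2 w'\<^sub>1) / (L L')\<close>; along the fiber over a fixed
  row the second coordinate of the orbit point moves in steps of \<open>q L\<close>.
\<close>

lemma SL2Z_eqI:
  fixes p q :: int and x :: "real^2" and l \<delta> :: real
  assumes \<gamma>: "\<gamma> \<in> SL2Z" and \<gamma>': "\<gamma>' \<in> SL2Z" and pq: "coprime p q" "q > 0"
    and L: "0 < l" "l \<le> \<bar>comb_form p q (act \<gamma> x)\<bar>" "\<bar>comb_form p q (act \<gamma> x)\<bar> \<le> \<delta>"
    and L': "l \<le> \<bar>comb_form p q (act \<gamma>' x)\<bar>" "\<bar>comb_form p q (act \<gamma>' x)\<bar> \<le> \<delta>"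
    and sgn: "comb_form p q (act \<gamma> x) > 0 \<longleftrightarrow> comb_form p q (act \<gamma>' x) > 0"
    and slope: "\<bar>(q * \<gamma> $ 1 $ 1 - p * \<gamma> $ 2 $ 1) / comb_form p q (act \<gamma> x)
        - (q * \<gamma>' $ 1 $ 1 - p * \<gamma>' $ 2 $ 1) / comb_form p q (act \<gamma>' x)\<bar> < \<bar>x $ 2\<bar> / \<delta>\<^sup>2"
    and close: "\<bar>act \<gamma> x $ 2 - act \<gamma>' x $ 2\<bar> < q * l"
  shows "\<gamma> = \<gamma>'"
proof -
  define w w' where "w j = q * \<gamma> $ 1 $ j - p * \<gamma> $ 2 $ j"
    and "w' j = q * \<gamma>' $ 1 $ j - p * \<gamma>' $ 2 $ j" for j
  define M M' where "M = comb_form p q (act \<gamma> x)" and "M' = comb_form p q (act \<gamma>' x)"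
  have M: "M = w 1 * x $ 1 + w 2 * x $ 2" and M': "M' = w' 1 * x $ 1 + w' 2 * x $ 2"
    by (simp_all add: M_def M'_def w_def w'_def comb_form_def act_nth algebra_simps)
  have nz: "M \<noteq> 0" "M' \<noteq> 0" "\<delta> > 0"
    using L L' by (auto simp: M_def M'_def)
  have "\<bar>w 1 / M - w' 1 / M'\<bar> < \<bar>x $ 2\<bar> / \<delta>\<^sup>2"
    using slope by (simp add: M_def M'_def w_def w'_def)
  moreover have "w 1 / M - w' 1 / M' = x $ 2 * (w 1 * w' 2 - w 2 * w' 1) / (M * M')"
    using nz by (simp add: field_simps) (simp add: M M' algebra_simps)
  ultimately have "\<bar>x $ 2\<bar> * \<bar>w 1 * w' 2 - w 2 * w' 1\<bar> / (\<bar>M\<bar> * \<bar>M'\<bar>) < \<bar>x $ 2\<bar> / \<delta>\<^sup>2"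
    by (simp add: abs_mult)
  moreover have "\<bar>M\<bar> * \<bar>M'\<bar> \<le> \<delta>\<^sup>2"
    unfolding power2_eq_square using L L' by (intro mult_mono) (auto simp: M_def M'_def)
  then have "\<bar>x $ 2\<bar> / \<delta>\<^sup>2 \<le> \<bar>x $ 2\<bar> / (\<bar>M\<bar> * \<bar>M'\<bar>)"
    using nz by (intro divide_left_mono) auto
  ultimately have "\<bar>x $ 2\<bar> * \<bar>w 1 * w' 2 - w 2 * w' 1\<bar> / (\<bar>M\<bar> * \<bar>M'\<bar>) < \<bar>x $ 2\<bar> / (\<bar>M\<bar> * \<bar>M'\<bar>)"
    by linarith
  then have "\<bar>x $ 2\<bar> * \<bar>w 1 * w' 2 - w 2 * w' 1\<bar> < \<bar>x $ 2\<bar> * 1"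
    using nz by (simp add: divide_less_cancel)
  then have "real_of_int \<bar>w 1 * w' 2 - w 2 * w' 1\<bar> < 1"
    by (metis abs_ge_zero mult_left_mono not_le)
  \<comment> \<open>The determinant of the two rows is an integer, so a bound below 1 makes it
    vanish.\<close>
  then have "w 1 * w' 2 = w 2 * w' 1"
    by linarith
  moreover have "coprime (w 1) (w 2)" "coprime (w' 1) (w' 2)"
    unfolding w_def w'_def using \<gamma> \<gamma>' pq(1) by (auto intro: SL2Z_coprime_combination)
  ultimately consider "w' 1 = w 1" "w' 2 = w 2" | "w' 1 = - w 1" "w' 2 = - w 2"
    by (metis parallel_primitive)
  then have "w' j = w j" for j
  proof cases
    case 1
    then show ?thesis using exhaust_2[of j] by auto
  next
    \<comment> \<open>Opposite rows give the form opposite values, which the sign hypothesis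
      excludes.\<close>
    case 2
    then have "M' = - M" by (simp add: M M')
    then show ?thesis using sgn nz by (auto simp flip: M_def M'_def)
  qed
  then obtain n where n: "\<And>j. \<gamma>' $ 1 $ j = \<gamma> $ 1 $ j + n * p * w j"
    "\<And>j. \<gamma>' $ 2 $ j = \<gamma> $ 2 $ j + n * q * w j"
    using SL2Z_fiber[OF \<gamma> \<gamma>' pq(1)] pq(2) unfolding w_def w'_def by (metis less_irrefl)
  have "act \<gamma> x $ 2 - act \<gamma>' x $ 2 = - (n * (q * M))"
    by (simp add: act_nth n M algebra_simps)
  then have "\<bar>n\<bar> * (q * \<bar>M\<bar>) < q * l"
    using close pq by (simp add: abs_mult)
  moreover have "q * l \<le> q * \<bar>M\<bar>"
    using L pq by (simp add: M_def)
  ultimately have "\<bar>n\<bar> * (q * \<bar>M\<bar>) < 1 * (q * \<bar>M\<bar>)"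
    by linarith
  then have "n = 0"
    using pq nz by (simp add: mult_less_cancel_right)
  then show ?thesis
    by (simp add: vec_eq_iff forall_2 n)
qed

text \<open>Pigeonhole principle: the sign contributes the factor 2, and the floors of numbers in
  \<open>[- S, S]\<close> take at most \<open>2 * S + 2\<close> values.\<close>

lemma card_floor_box:
  fixes S T :: real and s :: "'a \<Rightarrow> bool" and f h :: "'a \<Rightarrow> real"
  assumes "S \<ge> 0" "T \<ge> 0"
    and inj: "inj_on (\<lambda>g. (s g, \<lfloor>f g\<rfloor>, \<lfloor>h g\<rfloor>)) G"
    and bd: "\<And>g. g \<in> G \<Longrightarrow> \<bar>f g\<bar> \<le> S" "\<And>g. g \<in> G \<Longrightarrow> \<bar>h g\<bar> \<le> T"
  shows "card G \<le> 2 * (2 * S + 2) * (2 * T + 2)"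
proof -
  let ?B = "UNIV \<times> {\<lfloor>- S\<rfloor>..\<lfloor>S\<rfloor>} \<times> {\<lfloor>- T\<rfloor>..\<lfloor>T\<rfloor>} :: (bool \<times> int \<times> int) set"
  have "(\<lambda>g. (s g, \<lfloor>f g\<rfloor>, \<lfloor>h g\<rfloor>)) ` G \<subseteq> ?B"
    using bd by (auto simp: abs_le_iff minus_le_iff intro!: floor_mono)
  then have "card G \<le> card ?B"
    using inj by (intro card_inj_on_le) auto
  also have "real (card ?B) = 
      2 * (real_of_int \<lfloor>S\<rfloor> - \<lfloor>- S\<rfloor> + 1) * (real_of_int \<lfloor>T\<rfloor> - \<lfloor>- T\<rfloor> + 1)"
  proof -
    have "\<lfloor>- S\<rfloor> \<le> \<lfloor>S\<rfloor>" "\<lfloor>- T\<rfloor> \<le> \<lfloor>T\<rfloor>"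
      using assms(1,2) by (auto intro!: floor_mono)
    then show ?thesis
      by (simp add: card_cartesian_product)
  qed
  also have "\<dots> \<le> 2 * (2 * S + 2) * (2 * T + 2)"
    using assms(1,2) by (intro mult_mono mult_left_mono mult_nonneg_nonneg; linarith)
  finally show ?thesis by simp
qed

text \<open>Slopes are sorted into cells of width
  \<open>\<bar>x $ 2\<bar> / \<delta>\<^sup>2\<close> and second coordinates into cells of width
  \<open>q * l\<close>. By \<open>SL2Z_eqI\<close> a pair of cells and a sign of the form determine
  \<gamma>, so counting cells suffices.\<close>

lemma card_comb_form_le:
  fixes p q :: int and x :: "real^2" and l \<delta> :: real
  assumes G: "G \<subseteq> SL2Z" and x: "x $ 2 \<noteq> 0" and pq: "coprime p q" "q > 0"
    and pos: "0 < l" "0 < \<delta>" "0 \<le> S" "0 \<le> D"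
    and L: "\<And>\<gamma>. \<gamma> \<in> G \<Longrightarrow> l \<le> \<bar>comb_form p q (act \<gamma> x)\<bar>"
      "\<And>\<gamma>. \<gamma> \<in> G \<Longrightarrow> \<bar>comb_form p q (act \<gamma> x)\<bar> \<le> \<delta>"
    and D: "\<And>\<gamma>. \<gamma> \<in> G \<Longrightarrow> \<bar>act \<gamma> x $ 2\<bar> \<le> D"
    and S: "\<And>\<gamma>. \<gamma> \<in> G \<Longrightarrow>
      \<bar>(q * \<gamma> $ 1 $ 1 - p * \<gamma> $ 2 $ 1) / comb_form p q (act \<gamma> x)\<bar> \<le> S"
  shows "card G \<le> 2 * (2 * (S * \<delta>\<^sup>2 / \<bar>x $ 2\<bar>) + 2) * (2 * (D / (q * l)) + 2)"
proof -
  define c where "c = \<bar>x $ 2\<bar> / \<delta>\<^sup>2"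
  have c: "c > 0" and ql: "q * l > 0"
    using x pos pq by (auto simp: c_def)
  define f where "f \<gamma> = (q * \<gamma> $ 1 $ 1 - p * \<gamma> $ 2 $ 1) / comb_form p q (act \<gamma> x)" for \<gamma>
  have cell: "\<bar>u - v\<bar> < e" if "\<lfloor>u / e\<rfloor> = \<lfloor>v / e\<rfloor>" "e > 0" for u v e :: real
  proof -
    have "\<bar>u / e - v / e\<bar> < 1"
      using that(1) by linarith
    then show ?thesis
      using that(2) by (simp add: diff_divide_distrib[symmetric])
  qed
  have "card G \<le> 2 * (2 * (S / c) + 2) * (2 * (D / (q * l)) + 2)"
  proof (rule card_floor_box)
    show "inj_on (\<lambda>\<gamma>. (comb_form p q (act \<gamma> x) > 0, \<lfloor>f \<gamma> / c\<rfloor>, \<lfloor>act \<gamma> x $ 2 / (q * l)\<rfloor>)) G"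
    proof (rule inj_onI)
      fix \<gamma> \<gamma>'
      assume \<gamma>: "\<gamma> \<in> G" and \<gamma>': "\<gamma>' \<in> G"
        and eq: "(comb_form p q (act \<gamma> x) > 0, \<lfloor>f \<gamma> / c\<rfloor>, \<lfloor>act \<gamma> x $ 2 / (q * l)\<rfloor>) =
          (comb_form p q (act \<gamma>' x) > 0, \<lfloor>f \<gamma>' / c\<rfloor>, \<lfloor>act \<gamma>' x $ 2 / (q * l)\<rfloor>)"
      have "\<bar>f \<gamma> - f \<gamma>'\<bar> < c" "\<bar>act \<gamma> x $ 2 - act \<gamma>' x $ 2\<bar> < q * l"
        using eq by (auto intro: cell[OF _ c] cell[OF _ ql])
      then show "\<gamma> = \<gamma>'"
        using \<gamma> \<gamma>' G eq unfolding f_def c_def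
        by (intro SL2Z_eqI[OF _ _ pq pos(1) L L]) auto
    qed
    show "\<bar>f \<gamma> / c\<bar> \<le> S / c" if "\<gamma> \<in> G" for \<gamma>
      using S[OF that] c unfolding f_def[symmetric]
      by (simp only: abs_divide abs_of_pos divide_right_mono)
    show "\<bar>act \<gamma> x $ 2 / (q * l)\<bar> \<le> D / (q * l)" if "\<gamma> \<in> G" for \<gamma>
      using D[OF that] ql by (simp only: abs_divide abs_of_pos divide_right_mono)
  qed (use pos c ql in auto)
  then show ?thesis
    by (simp add: c_def)
qed

subsection \<open>Rational approximation of the slope of the line\<close>

text \<open>Only finitely many pairs violate the bound with exponent \<open>1 + \<epsilon>\<close>,
  and irrationality keeps their values of \<open>\<bar>q * y - p\<bar>\<close> positive;
  \<open>m\<close> lies at or below all of them. The exceptions are excluded by a small value rather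
  than a large \<open>q\<close>, because Dirichlet's theorem bounds denominators only from
  above.\<close>

lemma irrationality_measure_lower_bound:
  fixes y \<epsilon> :: real
  assumes "y \<notin> \<rat>" "irrationality_measure y \<le> 1" "\<epsilon> > 0"
  obtains m where "m > 0"
    "\<And>(p::int) (q::int). q \<noteq> 0 \<Longrightarrow> \<bar>q * y - p\<bar> < m \<Longrightarrow> \<bar>real_of_int q\<bar> powr - (1 + \<epsilon>) < \<bar>q * y - p\<bar>"
proof -
  let ?S = "\<lambda>\<omega>. {(v::int, u::int). v \<noteq> 0 \<and> \<bar>real_of_int v * y + real_of_int u\<bar>
    \<le> real_of_int \<bar>v\<bar> powr (- \<omega>)}"
  have fin: "finite (?S (1 + \<epsilon>))"
  proof (rule ccontr)
    assume "infinite (?S (1 + \<epsilon>))"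
    then have "ereal (1 + \<epsilon>) \<le> irrationality_measure y"
      unfolding irrationality_measure_def by (intro Sup_upper) blast
    also have "\<dots> \<le> ereal 1"
      using assms(2) by (simp add: one_ereal_def)
    finally show False
      using assms(3) by simp
  qed
  \<comment> \<open>The extra element 1 keeps the minimum defined when there are no exceptional
    pairs.\<close>
  let ?V = "insert 1 ((\<lambda>(v, u). \<bar>real_of_int v * y + real_of_int u\<bar>) ` ?S (1 + \<epsilon>))"
  have ne: "real_of_int v * y + real_of_int u \<noteq> 0" if "v \<noteq> 0" for v u :: int
  proof
    assume "real_of_int v * y + real_of_int u = 0"
    then have "y = - real_of_int u / real_of_int v"
      using that by (simp add: field_simps)
    then show False
      using assms(1) by simp
  qed
  show thesis
  proof (rule that[of "Min ?V"])
    show "Min ?V > 0"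
      using fin ne by (subst Min_gr_iff) auto
  next
    fix p q :: int
    assume q: "q \<noteq> 0" and less: "\<bar>q * y - p\<bar> < Min ?V"
    show "\<bar>real_of_int q\<bar> powr - (1 + \<epsilon>) < \<bar>q * y - p\<bar>"
    proof (rule ccontr)
      assume "\<not> ?thesis"
      then have "(q, - p) \<in> ?S (1 + \<epsilon>)"
        using q by auto
      then have "\<bar>q * y - p\<bar> \<in> ?V"
        by (intro insertI2 image_eqI[of _ _ "(q, - p)"]) auto
      then show False
        using less fin by (meson Min_le finite_imageI finite_insert not_le)
    qed
  qed
qed

text \<open>Dirichlet's theorem supplies \<open>p\<close> and \<open>q\<close>; once
  \<open>1 / Q\<close> is below the threshold \<open>m\<close>, the lower bound applies to them.
  Such pairs thus exist at every large scale \<open>Q\<close>, not only along a sequence of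
  scales.\<close>

lemma eventually_good_approx:
  fixes y \<epsilon> :: real
  assumes "y \<notin> \<rat>" "irrationality_measure y \<le> 1" "\<epsilon> > 0"
  shows "\<forall>\<^sub>F Q :: nat in sequentially. \<exists>p q :: int. coprime p q \<and> 0 < q \<and> q \<le> int Q \<and>
    \<bar>q * y - p\<bar> \<le> 1 / Q \<and> q powr - (1 + \<epsilon>) < \<bar>q * y - p\<bar>"
proof -
  obtain m where m: "m > 0"
    "\<And>(p::int) (q::int). q \<noteq> 0 \<Longrightarrow> \<bar>q * y - p\<bar> < m \<Longrightarrow> \<bar>real_of_int q\<bar> powr - (1 + \<epsilon>) < \<bar>q * y - p\<bar>"
    using irrationality_measure_lower_bound[OF assms] by blast
  have "(\<lambda>Q. 1 / real Q) \<longlonglongrightarrow> 0"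
    by (rule lim_1_over_n)
  then have "\<forall>\<^sub>F Q in sequentially. 1 / real Q < m"
    using m(1) by (auto dest: order_tendstoD)
  then show ?thesis
    using eventually_gt_at_top[of 0]
  proof eventually_elim
    case (elim Q)
    obtain p q where pq: "coprime p q" "0 < q" "q \<le> int Q" "\<bar>q * y - p\<bar> < 1 / Q"
      using Dirichlet_approx_coprime[of Q y] elim(2) by metis
    then have "q powr - (1 + \<epsilon>) < \<bar>q * y - p\<bar>"
      using elim(1) m(2)[of q p] by simp
    with pq show ?case
      by (intro exI[of _ p] exI[of _ q]) auto
  qed
qed

subsection \<open>Counting orbit points near the line\<close>

text \<open>At the point \<open>t (y, 1)\<close> the form equals \<open>(q y - p) t\<close>, of size
  between \<open>\<theta> / A\<close> and \<open>A * \<theta>\<close>. The hypothesis on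
  \<open>r\<close> limits the effect of the displacement from the line to half the lower
  bound.\<close>

lemma comb_form_estimates:
  fixes x :: "real^2" and p q :: int and y t r A N \<theta> :: real
  assumes \<gamma>: "\<gamma> \<in> SL2Z" and height: "mat_height \<gamma> \<le> 2 * N"
    and close: "infnorm (act \<gamma> x - t *\<^sub>R vector [y, 1]) \<le> r"
    and t: "1 / A \<le> \<bar>t\<bar>" "\<bar>t\<bar> \<le> A" and A: "A \<ge> 1" "r \<le> 1 / (2 * A)"
    and \<theta>: "\<theta> = \<bar>q * y - p\<bar>" "0 < \<theta>" "\<theta> \<le> 1" and q: "q > 0"
    and r: "(2 + \<bar>y\<bar>) * q * r \<le> \<theta> / (2 * A)"
  shows "\<theta> / (2 * A) \<le> \<bar>comb_form p q (act \<gamma> x)\<bar>" (is ?lower)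
    and "\<bar>comb_form p q (act \<gamma> x)\<bar> \<le> 2 * A * \<theta>" (is ?upper)
    and "\<bar>act \<gamma> x $ 2\<bar> \<le> 2 * A" (is ?bound)
    and "\<bar>(q * \<gamma> $ 1 $ 1 - p * \<gamma> $ 2 $ 1) / comb_form p q (act \<gamma> x)\<bar>
      \<le> 4 * A * N + 4 * A\<^sup>2 * q * \<bar>x $ 2\<bar> / \<theta>" (is ?slope)
proof -
  define z where "z = act \<gamma> x"
  define L where "L = comb_form p q z"
  have z1: "\<bar>z $ 1 - t * y\<bar> \<le> r" and z2: "\<bar>z $ 2 - t\<bar> \<le> r"
    using close by (auto simp: infnorm_eq_max z_def)
  have "r \<ge> 0"
    using z1 by linarith
  have "1 / (2 * A) \<le> 1"
    using A by simp
  then have Ainv: "1 / (2 * A) = 1 / A - 1 / (2 * A)" "1 / (2 * A) \<le> A"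
    using A by (simp, linarith)
  have z2_lower: "1 / (2 * A) \<le> \<bar>z $ 2\<bar>"
    using z2 t A Ainv by linarith
  show ?bound
    using z2 t A Ainv unfolding z_def by linarith
  have "\<bar>real_of_int p\<bar> \<le> q * \<bar>y\<bar> + 1"
  proof -
    have "\<bar>real_of_int p\<bar> \<le> \<bar>q * y\<bar> + \<bar>q * y - p\<bar>"
      by linarith
    then show ?thesis
      using \<theta> q by (simp add: abs_mult)
  qed
  moreover have "real_of_int q \<ge> 1"
    using q by simp
  ultimately have p: "q + \<bar>real_of_int p\<bar> \<le> (2 + \<bar>y\<bar>) * q"
    by (simp add: algebra_simps)
  have "L - (q * y - p) * t = q * (z $ 1 - t * y) - p * (z $ 2 - t)"
    by (simp add: L_def comb_form_def algebra_simps)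
  also have "\<bar>\<dots>\<bar> \<le> q * \<bar>z $ 1 - t * y\<bar> + \<bar>real_of_int p\<bar> * \<bar>z $ 2 - t\<bar>"
    using q abs_triangle_ineq4[of "q * (z $ 1 - t * y)" "p * (z $ 2 - t)"] by (simp add: abs_mult)
  also have "\<dots> \<le> q * r + \<bar>real_of_int p\<bar> * r"
    using q z1 z2 by (intro add_mono mult_left_mono) auto
  also have "\<dots> \<le> (2 + \<bar>y\<bar>) * q * r"
    using mult_right_mono[OF p \<open>r \<ge> 0\<close>] by (simp add: algebra_simps)
  also note r
  finally have err: "\<bar>L - (q * y - p) * t\<bar> \<le> \<theta> / (2 * A)" .
  have main: "\<bar>(q * y - p) * t\<bar> = \<theta> * \<bar>t\<bar>"
    by (simp add: \<theta>(1) abs_mult)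
  have lower: "\<theta> / (2 * A) \<le> \<bar>L\<bar>"
  proof -
    have "\<theta> * (1 / A) \<le> \<theta> * \<bar>t\<bar>"
      using t \<theta> by (intro mult_left_mono) auto
    moreover have "\<theta> * (1 / A) = \<theta> / (2 * A) + \<theta> / (2 * A)"
      by simp
    ultimately show ?thesis
      using err main by linarith
  qed
  then show ?lower
    by (simp add: L_def z_def)
  have "\<bar>L\<bar> \<le> 2 * A * \<theta>"
  proof -
    have "\<theta> * \<bar>t\<bar> \<le> \<theta> * A" "\<theta> * (1 / (2 * A)) \<le> \<theta> * A"
      using t \<theta> Ainv by (auto intro!: mult_left_mono simp del: times_divide_eq_right)
    then show ?thesis
      using err main by (simp add: algebra_simps)
  qed
  then show ?upper
    by (simp add: L_def z_def)
  define v where "v = real_of_int (\<gamma> $ 2 $ 1)"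
  have v: "\<bar>v\<bar> \<le> 2 * N"
    using height abs_le_mat_height[of \<gamma> 2 1] unfolding v_def by linarith
  have "L \<noteq> 0" "z $ 2 \<noteq> 0"
    using lower z2_lower \<theta> A by (auto simp: divide_le_0_iff)
  have "real_of_int (\<gamma> $ 1 $ 1 * \<gamma> $ 2 $ 2 - \<gamma> $ 1 $ 2 * \<gamma> $ 2 $ 1) = 1"
    using \<gamma> by (simp only: SL2Z_iff)
  then have det: "real_of_int (\<gamma> $ 1 $ 1) * \<gamma> $ 2 $ 2 - real_of_int (\<gamma> $ 1 $ 2) * \<gamma> $ 2 $ 1 = 1"
    by simp
  \<comment> \<open>The determinant relation turns the slope into \<open>v / z\<^sub>2\<close> plus a small error.\<close>
  have "(q * \<gamma> $ 1 $ 1 - p * \<gamma> $ 2 $ 1) * z $ 2 - v * L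
      = q * x $ 2 * (real_of_int (\<gamma> $ 1 $ 1) * \<gamma> $ 2 $ 2 - real_of_int (\<gamma> $ 1 $ 2) * \<gamma> $ 2 $ 1)"
    by (simp add: z_def L_def v_def comb_form_def act_nth algebra_simps)
  then have "(q * \<gamma> $ 1 $ 1 - p * \<gamma> $ 2 $ 1) * z $ 2 = v * L + q * x $ 2"
    unfolding det by simp
  then have slope: "(q * \<gamma> $ 1 $ 1 - p * \<gamma> $ 2 $ 1) / L = v / z $ 2 + q * x $ 2 / (L * z $ 2)"
    using \<open>L \<noteq> 0\<close> \<open>z $ 2 \<noteq> 0\<close> by (simp add: field_simps)
  have "\<bar>v / z $ 2\<bar> \<le> (2 * N) / (1 / (2 * A))"
    unfolding abs_divide using v z2_lower A by (intro frac_le) auto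
  moreover have "\<bar>q * x $ 2 / (L * z $ 2)\<bar> \<le> (q * \<bar>x $ 2\<bar>) / (\<theta> / (2 * A) * (1 / (2 * A)))"
    unfolding abs_divide abs_mult using lower z2_lower A \<theta> q
    by (intro frac_le mult_mono) auto
  moreover have "(2 * N) / (1 / (2 * A)) = 4 * A * N"
    "(q * \<bar>x $ 2\<bar>) / (\<theta> / (2 * A) * (1 / (2 * A))) = 4 * A\<^sup>2 * q * \<bar>x $ 2\<bar> / \<theta>"
    using A \<theta> by (simp_all add: field_simps power2_eq_square)
  ultimately have "\<bar>(q * \<gamma> $ 1 $ 1 - p * \<gamma> $ 2 $ 1) / L\<bar> \<le> 4 * A * N + 4 * A\<^sup>2 * q * \<bar>x $ 2\<bar> / \<theta>"
    unfolding slope using abs_triangle_ineq[of "v / z $ 2" "q * x $ 2 / (L * z $ 2)"] by linarith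
  then show ?slope
    by (simp add: L_def z_def)
qed

text \<open>The tolerance depends on \<open>N\<close> and not on the height. For \<mu> positive the
  set therefore contains each \<gamma> of height between \<open>N\<close> and \<open>2 * N\<close>
  that approaches a point of the piece within its own height to the power
  \<open>- \<mu>\<close>.\<close>

definition near_line_block :: "real^2 \<Rightarrow> real \<Rightarrow> real \<Rightarrow> real \<Rightarrow> real \<Rightarrow> (int^2^2) set"
  where "near_line_block x y \<mu> A N = {\<gamma> \<in> SL2Z. real_of_int (mat_height \<gamma>) \<le> 2 * N \<and>
    (\<exists>t. 1 / A \<le> \<bar>t\<bar> \<and> \<bar>t\<bar> \<le> A \<and> infnorm (act \<gamma> x - t *\<^sub>R vector [y, 1]) \<le> N powr - \<mu>)}"

lemma finite_near_line_block: "finite (near_line_block x y \<mu> A N)"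
proof (rule finite_subset)
  show "near_line_block x y \<mu> A N \<subseteq> {\<gamma>. mat_height \<gamma> \<le> \<lfloor>2 * N\<rfloor>}"
    by (auto simp: near_line_block_def le_floor_iff)
qed (rule finite_mat_height_le)

text \<open>The box count with \<open>l = \<theta> / (2 * A)\<close>,
  \<open>\<delta> = 2 * A * \<theta>\<close> and \<open>D = 2 * A\<close>. The first factor counts
  rows, the second the matrices over one row; \<open>q * \<theta> \<le> 1\<close> bounds the
  contribution of the second term of the slope estimate.\<close>

lemma card_near_line_block_le:
  fixes x :: "real^2" and p q :: int and y A N \<theta> :: real
  assumes x: "x $ 2 \<noteq> 0" and pq: "coprime p q" "q > 0" and N: "N \<ge> 0"
    and A: "A \<ge> 1" "N powr - \<mu> \<le> 1 / (2 * A)"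
    and \<theta>: "\<theta> = \<bar>q * y - p\<bar>" "0 < \<theta>" "\<theta> \<le> 1" "q * \<theta> \<le> 1"
    and r: "(2 + \<bar>y\<bar>) * q * N powr - \<mu> \<le> \<theta> / (2 * A)"
  shows "card (near_line_block x y \<mu> A N)
    \<le> 2 * (32 * A ^ 3 / \<bar>x $ 2\<bar> * (N * \<theta>\<^sup>2) + 32 * A ^ 4 + 2) * (8 * A\<^sup>2 / (q * \<theta>) + 2)"
proof -
  define S where "S = 4 * A * N + 4 * A\<^sup>2 * q * \<bar>x $ 2\<bar> / \<theta>"
  have "S \<ge> 0"
    using A N \<theta> pq by (simp add: S_def)
  have est: "\<theta> / (2 * A) \<le> \<bar>comb_form p q (act \<gamma> x)\<bar>"
      "\<bar>comb_form p q (act \<gamma> x)\<bar> \<le> 2 * A * \<theta>" "\<bar>act \<gamma> x $ 2\<bar> \<le> 2 * A"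
      "\<bar>(q * \<gamma> $ 1 $ 1 - p * \<gamma> $ 2 $ 1) / comb_form p q (act \<gamma> x)\<bar> \<le> S"
    if "\<gamma> \<in> near_line_block x y \<mu> A N" for \<gamma>
  proof -
    from that obtain t where "\<gamma> \<in> SL2Z" "mat_height \<gamma> \<le> 2 * N" "1 / A \<le> \<bar>t\<bar>" "\<bar>t\<bar> \<le> A"
        "infnorm (act \<gamma> x - t *\<^sub>R vector [y, 1]) \<le> N powr - \<mu>"
      by (auto simp: near_line_block_def)
    note * = comb_form_estimates[OF this(1,2,5,3,4) A \<theta>(1-3) pq(2) r]
    show "\<theta> / (2 * A) \<le> \<bar>comb_form p q (act \<gamma> x)\<bar>"
        "\<bar>comb_form p q (act \<gamma> x)\<bar> \<le> 2 * A * \<theta>" "\<bar>act \<gamma> x $ 2\<bar> \<le> 2 * A"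
        "\<bar>(q * \<gamma> $ 1 $ 1 - p * \<gamma> $ 2 $ 1) / comb_form p q (act \<gamma> x)\<bar> \<le> S"
      using * unfolding S_def by blast+
  qed
  have "card (near_line_block x y \<mu> A N)
      \<le> 2 * (2 * (S * (2 * A * \<theta>)\<^sup>2 / \<bar>x $ 2\<bar>) + 2) * (2 * (2 * A / (q * (\<theta> / (2 * A)))) + 2)"
  proof (rule card_comb_form_le[OF _ x pq _ _ \<open>S \<ge> 0\<close> _ est])
    show "near_line_block x y \<mu> A N \<subseteq> SL2Z"
      by (auto simp: near_line_block_def)
  qed (use A \<theta>(2) in auto)
  also have "S * (2 * A * \<theta>)\<^sup>2 / \<bar>x $ 2\<bar> = 16 * A ^ 3 / \<bar>x $ 2\<bar> * (N * \<theta>\<^sup>2) + 16 * A ^ 4 * (q * \<theta>)"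
    using x \<theta> by (simp add: S_def field_simps power2_eq_square power3_eq_cube power4_eq_xxxx)
  also have "2 * A / (q * (\<theta> / (2 * A))) = 4 * A\<^sup>2 / (q * \<theta>)"
    by (simp add: power2_eq_square)
  also have "2 * (2 * (16 * A ^ 3 / \<bar>x $ 2\<bar> * (N * \<theta>\<^sup>2) + 16 * A ^ 4 * (q * \<theta>)) + 2)
        * (2 * (4 * A\<^sup>2 / (q * \<theta>)) + 2)
      \<le> 2 * (2 * (16 * A ^ 3 / \<bar>x $ 2\<bar> * (N * \<theta>\<^sup>2) + 16 * A ^ 4 * 1) + 2) * (2 * (4 * A\<^sup>2 / (q * \<theta>)) + 2)"
    using A \<theta> pq by (intro mult_right_mono mult_left_mono add_mono) auto
  finally show ?thesis
    by (simp add: algebra_simps)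
qed

text \<open>The weight \<open>N powr - \<mu>\<close> is the radius of the interval of parameters
  \<open>t\<close> that each \<gamma> will exclude, so decay of the product makes the excluded
  measure summable over dyadic \<open>N\<close>.\<close>

lemma eventually_card_near_line_block:
  fixes x :: "real^2" and y \<mu> A :: real
  assumes x: "x $ 2 \<noteq> 0" and y: "y \<notin> \<rat>" "irrationality_measure y \<le> 1"
    and \<mu>: "1 / 2 < \<mu>" "\<mu> \<le> 1" and A: "A \<ge> 1"
  obtains C where "\<forall>\<^sub>F N in at_top.
    card (near_line_block x y \<mu> A N) * N powr - \<mu> \<le> C * N powr - (\<mu> - 1 / 2)"
proof -
  \<comment> \<open>The approximation \<open>p / q\<close> is chosen at scale \<open>N powr \<beta>\<close> with \<open>\<beta>\<close> just below \<open>\<mu> / 2\<close>: as large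
    as possible while the errors \<open>N powr - \<mu>\<close> of the orbit point stay negligible in \<open>q z\<^sub>1 - p z\<^sub>2\<close>.\<close>
  define \<epsilon> where "\<epsilon> = (\<mu> - 1 / 2) / 2"
  define \<beta> where "\<beta> = (\<mu> - \<epsilon>) / 2"
  have \<epsilon>: "0 < \<epsilon>" "\<epsilon> < \<mu>"
    using \<mu> by (simp_all add: \<epsilon>_def field_simps)
  then have \<beta>: "0 < \<beta>" "2 * \<beta> \<le> 1" "\<beta> < 1"
    using \<mu> by (simp_all add: \<beta>_def field_simps)
  \<comment> \<open>This is the exponent of the relative error: \<theta> exceeds
    \<open>q powr - (1 + \<epsilon>)\<close>, so \<open>q * N powr - \<mu> / \<theta>\<close> is at
    most \<open>q powr (2 + \<epsilon>) * N powr - \<mu>\<close>, where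
    \<open>q \<le> N powr \<beta>\<close>.\<close>
  have expo: "\<beta> * (2 + \<epsilon>) - \<mu> < 0"
  proof -
    have "\<beta> * (2 + \<epsilon>) - \<mu> = \<epsilon> * (\<beta> - 1)"
      by (simp add: \<beta>_def field_simps)
    also have "\<dots> < 0"
      using \<epsilon> \<beta> by (intro mult_pos_neg) auto
    finally show ?thesis .
  qed
  define Q where "Q N = nat \<lfloor>N powr \<beta>\<rfloor>" for N :: real
  have powr_top: "filterlim (\<lambda>N. N powr \<beta>) at_top (at_top :: real filter)"
    using \<beta>(1) by real_asymp
  have "filterlim Q sequentially at_top"
    unfolding Q_def
    by (rule filterlim_compose[OF filterlim_nat_sequentially])
      (rule filterlim_compose[OF filterlim_floor_sequentially powr_top])
  then have ev_approx: "\<forall>\<^sub>F N in at_top. \<exists>p q :: int. coprime p q \<and> 0 < q \<and> q \<le> int (Q N) \<and>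
      \<bar>q * y - p\<bar> \<le> 1 / Q N \<and> q powr - (1 + \<epsilon>) < \<bar>q * y - p\<bar>"
    by (rule eventually_compose_filterlim[OF eventually_good_approx[OF y \<epsilon>(1)]])
  have "((\<lambda>N. N powr - \<mu>) \<longlongrightarrow> 0) (at_top :: real filter)"
    using \<mu> by real_asymp
  then have ev_r: "\<forall>\<^sub>F N :: real in at_top. N powr - \<mu> < 1 / (2 * A)"
    using A by (intro order_tendstoD) auto
  have "((\<lambda>N. (2 + \<bar>y\<bar>) * (2 * A) * N powr (\<beta> * (2 + \<epsilon>) - \<mu>)) \<longlongrightarrow> 0) (at_top :: real filter)"
    using expo by real_asymp
  then have ev_err: "\<forall>\<^sub>F N :: real in at_top. (2 + \<bar>y\<bar>) * (2 * A) * N powr (\<beta> * (2 + \<epsilon>) - \<mu>) < 1"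
    by (intro order_tendstoD) auto
  \<comment> \<open>Here 128 is 32 times the 4 in \<open>N * \<theta>\<^sup>2 \<le> 4 * X\<close>;
    the other summands are absorbed using \<open>X \<ge> 1\<close> and
    \<open>Y \<ge> 1\<close>.\<close>
  define C where "C = 2 * (128 * A ^ 3 / \<bar>x $ 2\<bar> + 32 * A ^ 4 + 2) * (8 * A\<^sup>2 + 2)"
  have "\<forall>\<^sub>F N in at_top. card (near_line_block x y \<mu> A N) * N powr - \<mu> \<le> C * N powr - (\<mu> - 1 / 2)"
    using ev_approx ev_r ev_err eventually_ge_at_top[of 1]
  proof eventually_elim
    case (elim N)
    from elim(1) obtain p q :: int where pq: "coprime p q" "0 < q" "q \<le> int (Q N)"
        "\<bar>q * y - p\<bar> \<le> 1 / Q N" "q powr - (1 + \<epsilon>) < \<bar>q * y - p\<bar>"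
      by blast
    define \<theta> where "\<theta> = \<bar>q * y - p\<bar>"
    have q1: "real_of_int q \<ge> 1"
      using pq(2) by simp
    have N\<beta>: "N powr \<beta> \<ge> 1"
      using elim(4) \<beta> by (simp add: ge_one_powr_ge_zero)
    have QN: "Q N \<le> N powr \<beta>" "N powr \<beta> \<le> 2 * real (Q N)" "real (Q N) \<ge> 1"
    proof -
      have fl: "\<lfloor>N powr \<beta>\<rfloor> \<ge> 1"
        using N\<beta> by (simp add: le_floor_iff)
      then have "real (Q N) = real_of_int \<lfloor>N powr \<beta>\<rfloor>"
        by (simp add: Q_def)
      moreover have "real_of_int \<lfloor>N powr \<beta>\<rfloor> \<ge> 1"
        using fl by simp
      ultimately show "Q N \<le> N powr \<beta>" "N powr \<beta> \<le> 2 * real (Q N)" "real (Q N) \<ge> 1"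
        using real_of_int_floor_add_one_ge[of "N powr \<beta>"] of_int_floor_le[of "N powr \<beta>"]
        by linarith+
    qed
    have qN: "q \<le> N powr \<beta>"
      using pq(3) QN(1) by linarith
    have \<theta>: "0 < \<theta>" "\<theta> \<le> 1 / Q N"
      using pq(4,5) order_le_less_trans[OF powr_ge_zero] unfolding \<theta>_def by blast+
    have \<theta>1: "\<theta> \<le> 1" "q * \<theta> \<le> 1"
    proof -
      have "1 / real (Q N) \<le> 1"
        using QN(3) by simp
      then show "\<theta> \<le> 1"
        using \<theta> by linarith
      have "real_of_int q \<le> Q N"
        using pq(3) by linarith
      then have "q * \<theta> \<le> Q N * (1 / Q N)"
        using \<theta> QN(3) by (intro mult_mono) auto
      then show "q * \<theta> \<le> 1"
        using QN(3) by simp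
    qed
    have "q powr (2 + \<epsilon>) \<le> (N powr \<beta>) powr (2 + \<epsilon>)"
      using q1 qN \<epsilon> by (intro powr_mono2) auto
    then have q2: "q powr (2 + \<epsilon>) \<le> N powr (\<beta> * (2 + \<epsilon>))"
      by (simp add: powr_powr)
    have err: "(2 + \<bar>y\<bar>) * q * N powr - \<mu> \<le> \<theta> / (2 * A)"
    proof -
      have "((2 + \<bar>y\<bar>) * q * N powr - \<mu>) * (2 * A)
          = ((2 + \<bar>y\<bar>) * (2 * A) * N powr - \<mu>) * q powr (2 + \<epsilon>) * q powr - (1 + \<epsilon>)"
      proof -
        have "q powr (2 + \<epsilon>) * q powr - (1 + \<epsilon>) = q"
          using q1 by (simp flip: powr_add)
        then show ?thesis
          by (simp add: mult_ac)
      qed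
      also have "\<dots> \<le> ((2 + \<bar>y\<bar>) * (2 * A) * N powr - \<mu>) * N powr (\<beta> * (2 + \<epsilon>)) * q powr - (1 + \<epsilon>)"
        using q2 A by (intro mult_right_mono mult_left_mono) auto
      also have "\<dots> = ((2 + \<bar>y\<bar>) * (2 * A) * N powr (\<beta> * (2 + \<epsilon>) - \<mu>)) * q powr - (1 + \<epsilon>)"
        by (simp add: powr_diff powr_minus field_simps)
      also have "\<dots> \<le> 1 * q powr - (1 + \<epsilon>)"
        using elim(3) by (intro mult_right_mono) auto
      also have "\<dots> \<le> \<theta>"
        using pq(5) by (simp add: \<theta>_def)
      finally show ?thesis
        using A by (simp add: field_simps)
    qed
    define X Y where "X = N powr (1 - 2 * \<beta>)" and "Y = N powr \<epsilon>"
    have XY: "X \<ge> 1" "Y \<ge> 1"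
      using elim(4) \<beta> \<epsilon> by (auto simp: X_def Y_def ge_one_powr_ge_zero)
    have "\<theta> \<le> 2 * N powr - \<beta>"
    proof -
      have "1 / real (Q N) \<le> 2 / N powr \<beta>"
        using frac_le[of 2 2 "N powr \<beta>" "2 * real (Q N)"] QN N\<beta> elim(4) by simp
      then show ?thesis
        using \<theta> by (simp add: powr_minus field_simps)
    qed
    then have "N * \<theta>\<^sup>2 \<le> N * (2 * N powr - \<beta>)\<^sup>2"
      using \<theta> elim(4) by (intro mult_left_mono power_mono) auto
    also have "\<dots> = 4 * X"
      using elim(4) by (simp add: X_def power_mult_distrib powr_power powr_diff powr_minus field_simps)
    finally have N\<theta>: "N * \<theta>\<^sup>2 \<le> 4 * X" .
    \<comment> \<open>The irrationality measure controls the fibers: their size costs only a factor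
      \<open>q powr \<epsilon>\<close>, for which the crude bound \<open>q \<le> N\<close> is
      enough.\<close>
    have "1 / (q * \<theta>) \<le> 1 / (q * q powr - (1 + \<epsilon>))"
      using q1 pq(5) \<theta> by (intro divide_left_mono mult_left_mono mult_pos_pos) (auto simp: \<theta>_def)
    also have "\<dots> = q powr \<epsilon>"
    proof -
      have "(q powr 1 * q powr - (1 + \<epsilon>)) * q powr \<epsilon> = 1"
        unfolding powr_add[symmetric] using q1 by simp
      then have "(q * q powr - (1 + \<epsilon>)) * q powr \<epsilon> = 1"
        using q1 by simp
      from inverse_unique[OF this] show ?thesis
        by (simp only: inverse_eq_divide)
    qed
    also have "\<dots> \<le> N powr \<epsilon>"
    proof (rule powr_mono2)
      have "N powr \<beta> \<le> N powr 1"
        using elim(4) \<beta> by (intro powr_mono) auto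
      then show "q \<le> N"
        using qN elim(4) by simp
    qed (use q1 \<epsilon> in auto)
    finally have q\<theta>: "1 / (q * \<theta>) \<le> Y"
      by (simp add: Y_def)
    have "card (near_line_block x y \<mu> A N)
        \<le> 2 * (32 * A ^ 3 / \<bar>x $ 2\<bar> * (N * \<theta>\<^sup>2) + 32 * A ^ 4 + 2) * (8 * A\<^sup>2 * (1 / (q * \<theta>)) + 2)"
      using card_near_line_block_le[OF x pq(1,2) _ A less_imp_le[OF elim(2)] \<theta>_def \<theta>(1) \<theta>1 err]
        elim(4) by simp
    also have "\<dots> \<le> 2 * (32 * A ^ 3 / \<bar>x $ 2\<bar> * (4 * X) + 32 * A ^ 4 * X + 2 * X) * (8 * A\<^sup>2 * Y + 2 * Y)"
    proof (rule mult_mono)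
      have X1: "32 * A ^ 3 / \<bar>x $ 2\<bar> * (N * \<theta>\<^sup>2) \<le> 32 * A ^ 3 / \<bar>x $ 2\<bar> * (4 * X)"
        using A by (intro mult_left_mono[OF N\<theta>]) auto
      have X2: "32 * A ^ 4 \<le> 32 * A ^ 4 * X"
        using mult_left_mono[OF XY(1), of "32 * A ^ 4"] A by simp
      show "2 * (32 * A ^ 3 / \<bar>x $ 2\<bar> * (N * \<theta>\<^sup>2) + 32 * A ^ 4 + 2)
          \<le> 2 * (32 * A ^ 3 / \<bar>x $ 2\<bar> * (4 * X) + 32 * A ^ 4 * X + 2 * X)"
        using XY by (intro mult_left_mono add_mono X1 X2) simp_all
      show "8 * A\<^sup>2 * (1 / (q * \<theta>)) + 2 \<le> 8 * A\<^sup>2 * Y + 2 * Y"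
        using XY by (intro add_mono mult_left_mono[OF q\<theta>]) simp_all
    qed (use A XY \<theta> q1 in auto)
    also have "\<dots> = C * (X * Y)"
      by (simp add: C_def algebra_simps)
    finally have "card (near_line_block x y \<mu> A N) * N powr - \<mu> \<le> C * (X * Y) * N powr - \<mu>"
      by (intro mult_right_mono) auto
    also have "\<dots> = C * N powr (1 - 2 * \<beta> + \<epsilon> + - \<mu>)"
      unfolding X_def Y_def powr_add by (simp only: mult.assoc)
    \<comment> \<open>By the choice of \<beta> the left side is
      \<open>1 - 2 * \<mu> + 2 * \<epsilon>\<close>, and \<epsilon> was chosen to spend half of the
      gain \<open>2 * \<mu> - 1\<close>.\<close>
    also have "1 - 2 * \<beta> + \<epsilon> + - \<mu> = - (\<mu> - 1 / 2)"
      by (simp add: \<beta>_def \<epsilon>_def field_simps)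
    finally show ?case .
  qed
  then show thesis
    by (rule that)
qed

subsection \<open>Almost every point of the line\<close>

text \<open>Borel-Cantelli over heights near \<open>2 ^ k\<close>: the measures of the exceptional
  sets are dominated by a geometric series, so almost every \<open>t\<close> avoids all but finitely
  many of them. This bounds the heights of the approximating matrices.\<close>

lemma AE_finite_close:
  fixes x :: "real^2" and y \<mu> A :: real
  assumes x: "x $ 2 \<noteq> 0" and y: "y \<notin> \<rat>" "irrationality_measure y \<le> 1"
    and \<mu>: "1 / 2 < \<mu>" "\<mu> \<le> 1" and A: "A \<ge> 1"
  shows "AE t in lebesgue. 1 / A \<le> \<bar>t\<bar> \<and> \<bar>t\<bar> \<le> A \<longrightarrow>
    finite {\<gamma> \<in> SL2Z. infnorm (act \<gamma> x - t *\<^sub>R vector [y, 1]) \<le> real_of_int (mat_height \<gamma>) powr - \<mu>}"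
proof -
  define r where "r k = (2 ^ k) powr - \<mu>" for k :: nat
  define G where "G k = near_line_block x y \<mu> A (2 ^ k)" for k :: nat
  \<comment> \<open>The second coordinate of \<open>t (y, 1)\<close> is \<open>t\<close> itself, so
    closeness of an orbit point to it confines \<open>t\<close> to such an interval.\<close>
  define B where "B k = (\<Union>\<gamma>\<in>G k. {act \<gamma> x $ 2 - r k..act \<gamma> x $ 2 + r k})" for k
  have fin: "finite (G k)" for k
    by (simp add: G_def finite_near_line_block)
  have B: "B k \<in> lmeasurable" for k
    unfolding B_def using fin by (intro fmeasurable.finite_UN) auto
  have B_le: "measure lebesgue (B k) \<le> 2 * (card (G k) * r k)" for k
  proof -
    have "measure lebesgue (B k) \<le> (\<Sum>\<gamma>\<in>G k. measure lebesgue {act \<gamma> x $ 2 - r k..act \<gamma> x $ 2 + r k})"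
      unfolding B_def using fin by (intro measure_UNION_le) auto
    also have "\<dots> = 2 * (card (G k) * r k)"
      by (simp add: r_def)
    finally show ?thesis .
  qed
  obtain C where C: "\<forall>\<^sub>F N in at_top.
      card (near_line_block x y \<mu> A N) * N powr - \<mu> \<le> C * N powr - (\<mu> - 1 / 2)"
    by (rule eventually_card_near_line_block[OF assms])
  define \<rho> where "\<rho> = 2 powr - (\<mu> - 1 / 2)"
  have "filterlim (\<lambda>k. 2 ^ k :: real) at_top sequentially"
    by real_asymp
  from eventually_compose_filterlim[OF C this]
  have "\<forall>\<^sub>F k in sequentially. norm (measure lebesgue (B k)) \<le> 2 * C * \<rho> ^ k"
  proof eventually_elim
    case (elim k)
    have "(2 ^ k) powr - (\<mu> - 1 / 2) = \<rho> ^ k"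
      unfolding \<rho>_def by (simp add: powr_powr powr_realpow[symmetric] mult_ac)
    then show ?case
      using elim B_le[of k] by (simp add: G_def r_def)
  qed
  moreover have "summable (\<lambda>k. 2 * C * \<rho> ^ k)"
    using \<mu> by (intro summable_mult summable_geometric) (simp add: \<rho>_def powr_less_one)
  ultimately have "summable (\<lambda>k. measure lebesgue (B k))"
    by (rule summable_comparison_test_ev)
  moreover have "B k \<in> sets lebesgue" "emeasure lebesgue (B k) < \<infinity>" for k
    using B[of k] by (simp_all only: fmeasurable_def mem_Collect_eq infinity_ennreal_def)
  ultimately have "AE t in lebesgue. \<forall>\<^sub>F k in sequentially. t \<in> space lebesgue - B k"
    by (intro borel_cantelli_AE1)
  then show ?thesis
  proof (rule AE_mp, intro AE_I2 impI)
    fix t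
    assume "\<forall>\<^sub>F k in sequentially. t \<in> space lebesgue - B k" and t: "1 / A \<le> \<bar>t\<bar> \<and> \<bar>t\<bar> \<le> A"
    then obtain K where K: "\<And>k. k \<ge> K \<Longrightarrow> t \<notin> B k"
      by (auto simp: eventually_sequentially)
    show "finite {\<gamma> \<in> SL2Z. infnorm (act \<gamma> x - t *\<^sub>R vector [y, 1])
        \<le> real_of_int (mat_height \<gamma>) powr - \<mu>}" (is "finite ?S")
    proof (rule finite_subset)
      show "?S \<subseteq> {\<gamma>. mat_height \<gamma> \<le> 2 ^ K}"
      proof (rule subsetI, rule ccontr)
        fix \<gamma>
        assume "\<gamma> \<in> ?S" "\<gamma> \<notin> {\<gamma>. mat_height \<gamma> \<le> 2 ^ K}"
        then have \<gamma>: "\<gamma> \<in> SL2Z"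
            "infnorm (act \<gamma> x - t *\<^sub>R vector [y, 1]) \<le> real_of_int (mat_height \<gamma>) powr - \<mu>"
            "mat_height \<gamma> > 2 ^ K"
          by auto
        have pos: "mat_height \<gamma> > 0"
          using mat_height_pos[OF \<gamma>(1)] .
        \<comment> \<open>The dyadic exponent \<open>k\<close> of the height is at least
          \<open>K\<close>, because \<open>2 ^ K < 2 ^ (k + 1)\<close>; so \<gamma> falls in a block
          whose exceptional set avoids \<open>t\<close>.\<close>
        then have "1 \<le> nat (mat_height \<gamma>)"
          by linarith
        then obtain k where "2 ^ k \<le> nat (mat_height \<gamma>)" "nat (mat_height \<gamma>) < 2 ^ (k + 1)"
          using ex_power_ivl1[OF order_refl] by blast
        then have k: "2 ^ k \<le> mat_height \<gamma>" "mat_height \<gamma> < 2 ^ (k + 1)"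
          using pos by (simp_all add: le_nat_iff nat_less_iff)
        have "(2::int) ^ K < 2 ^ (k + 1)"
          using \<gamma>(3) k(2) by linarith
        then have "K \<le> k"
          using power_less_imp_less_exp[of "2::int" K "k + 1"] by simp
        have k': "2 ^ k \<le> real_of_int (mat_height \<gamma>)" "real_of_int (mat_height \<gamma>) \<le> 2 * 2 ^ k"
        proof -
          have "real_of_int (2 ^ k) \<le> mat_height \<gamma>" "mat_height \<gamma> \<le> real_of_int (2 * 2 ^ k)"
            using k by (simp_all only: of_int_le_iff power_add mult.commute) auto
          then show "2 ^ k \<le> real_of_int (mat_height \<gamma>)" "real_of_int (mat_height \<gamma>) \<le> 2 * 2 ^ k"
            by simp_all
        qed
        have "real_of_int (mat_height \<gamma>) powr - \<mu> \<le> r k"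
          unfolding r_def using k' \<mu> by (intro powr_mono2') auto
        then have close: "infnorm (act \<gamma> x - t *\<^sub>R vector [y, 1]) \<le> r k"
          using \<gamma>(2) by linarith
        then have "\<gamma> \<in> G k"
          using \<gamma>(1) k' t unfolding G_def near_line_block_def r_def by blast
        moreover have "t \<in> {act \<gamma> x $ 2 - r k..act \<gamma> x $ 2 + r k}"
          using close by (auto simp: infnorm_eq_max abs_le_iff)
        ultimately have "t \<in> B k"
          unfolding B_def by blast
        then show False
          using K \<open>K \<le> k\<close> by blast
      qed
    qed (rule finite_mat_height_le)
  qed
qed

text \<open>Heights are at least 1, so finiteness for one exponent passes to all larger ones, and a
  sequence decreasing to 1/2 suffices. The shift \<open>n + 2\<close> keeps the exponents at most 1,
  the range of the counting bound.\<close>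

lemma orbit_exponent_le_half:
  assumes fin: "\<And>n :: nat. finite {\<gamma> \<in> SL2Z.
    infnorm (act \<gamma> x - y) \<le> real_of_int (mat_height \<gamma>) powr - (1 / 2 + 1 / (n + 2))}"
  shows "orbit_exponent x y \<le> 1 / 2"
  unfolding orbit_exponent_def
proof (rule Sup_least, safe)
  fix \<mu>
  assume inf: "infinite {\<gamma> \<in> SL2Z. infnorm (act \<gamma> x - y) \<le> real_of_int (mat_height \<gamma>) powr - \<mu>}"
  have "\<mu> \<le> 1 / 2"
  proof (rule ccontr)
    assume "\<not> \<mu> \<le> 1 / 2"
    then obtain n :: nat where n: "1 / real (Suc n) < \<mu> - 1 / 2"
      using nat_approx_posE[of "\<mu> - 1 / 2"] by auto
    have "1 / real (n + 2) \<le> 1 / real (Suc n)"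
      by (simp add: field_simps)
    then have le: "1 / 2 + 1 / real (n + 2) \<le> \<mu>"
      using n by linarith
    have "{\<gamma> \<in> SL2Z. infnorm (act \<gamma> x - y) \<le> real_of_int (mat_height \<gamma>) powr - \<mu>}
        \<subseteq> {\<gamma> \<in> SL2Z. infnorm (act \<gamma> x - y)
          \<le> real_of_int (mat_height \<gamma>) powr - (1 / 2 + 1 / real (n + 2))}"
    proof safe
      fix \<gamma>
      assume \<gamma>: "\<gamma> \<in> SL2Z" "infnorm (act \<gamma> x - y) \<le> real_of_int (mat_height \<gamma>) powr - \<mu>"
      have "real_of_int (mat_height \<gamma>) powr - \<mu>
          \<le> real_of_int (mat_height \<gamma>) powr - (1 / 2 + 1 / real (n + 2))"
        using le mat_height_pos[OF \<gamma>(1)] by (intro powr_mono) auto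
      then show "infnorm (act \<gamma> x - y)
          \<le> real_of_int (mat_height \<gamma>) powr - (1 / 2 + 1 / real (n + 2))"
        using \<gamma>(2) by linarith
    qed
    then show False
      using inf fin[of n] finite_subset by (simp add: add.commute) blast
  qed
  then have "ereal \<mu> \<le> ereal (1 / 2)"
    by simp
  then show "ereal \<mu> \<le> 1 / 2"
    by (simp add: one_ereal_def)
qed

text \<open>Length on the line is a constant multiple of Lebesgue measure in the parameter
  \<open>t\<close>, so the null sets agree.\<close>

theorem theorem3:
  fixes x :: "real^2" and y :: real
  assumes "irrational_slope x"
    and "y \<notin> \<rat>"
    and "irrationality_measure y = 1"
  shows "AE t in lebesgue. orbit_exponent x (t *\<^sub>R vector [y, 1]) \<le> 1 / 2"
proof -
  have x: "x $ 2 \<noteq> 0"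
    using assms(1) by (simp add: irrational_slope_def)
  \<comment> \<open>Countably many exponents and compact pieces give one common null set; the pieces
    exhaust the line except for the origin.\<close>
  have "AE t in lebesgue. \<forall>(n::nat) (a::nat). 1 / real (Suc a) \<le> \<bar>t\<bar> \<and> \<bar>t\<bar> \<le> real (Suc a) \<longrightarrow>
      finite {\<gamma> \<in> SL2Z. infnorm (act \<gamma> x - t *\<^sub>R vector [y, 1])
        \<le> real_of_int (mat_height \<gamma>) powr - (1 / 2 + 1 / (n + 2))}"
    unfolding AE_all_countable using x assms(2,3)
    by (intro allI AE_finite_close) (auto simp: field_simps)
  moreover have "AE t in lebesgue. t \<noteq> (0 :: real)"
    by (rule AE_I'[of "{0}"]) auto
  ultimately show ?thesis
  proof eventually_elim
    case (elim t)
    obtain a :: nat where a: "max \<bar>t\<bar> (1 / \<bar>t\<bar>) \<le> a"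
      using real_arch_simple by blast
    have "\<bar>t\<bar> \<le> real (Suc a)" "1 / real (Suc a) \<le> \<bar>t\<bar>"
      using a elim(2) by (auto simp: field_simps)
    then show ?case
      using elim(1) by (intro orbit_exponent_le_half) blast
  qed
qed

end
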